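(* Let $X$ be an Archimedean vector lattice. Every uniformly closed subspace of $X$ of finite codimension is an intersection of uniformly closed subspaces of $X$ of codimension $1$.
   Context: Vector lattices are over $\mathbb R$. For $e\in X_+$, $I_e$ is the principal ideal generated by $e$, with the norm $\|x\|_e=\inf\{\lambda>0 : |x|\le\lambda e\}$. A net $(x_\alpha)$ in $X$ converges (relatively) uniformly to $x\in X$ if there is $e\in X_+$ with $\|x_\alpha-x\|_e\to 0$ (in particular, $x_\alpha-x\in I_e$ for all sufficiently large $\alpha$). A subset $A\subseteq X$ is uniformly closed if it is closed with respect to uniform convergence; equivalently, $A\cap I_e$ is closed in $(I_e,\|\cdot\|_e)$ for every $e\in X_+$. A subspace $F$ of $X$ has codimension $n$ if $\dim X/F=n$. The empty intersection of subspaces of $X$ is understood to be $X$. *)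

theory Defs
  imports Complex_Main "HOL-Library.Lattice_Algebras" "HOL-Library.Set_Algebras"
begin

section \<open>Archimedean vector lattices\<close>

text \<open>The modulus is part of the class signature, but it is determined by the lattice operations
  (\<open>abs_lattice\<close>: \<open>\<bar>x\<bar> = sup x (- x)\<close>).\<close>

class vector_lattice = ordered_real_vector + lattice_ab_group_add_abs

class archimedean_vector_lattice = vector_lattice +
  assumes archimedean: "(\<And>n::nat. real n *\<^sub>R x \<le> y) \<Longrightarrow> x \<le> 0"

instance real :: archimedean_vector_lattice
proof
  fix x y :: real
  assume *: "\<And>n::nat. real n *\<^sub>R x \<le> y"
  show "x \<le> 0"
  proof (rule ccontr)
    assume "\<not> x \<le> 0"
    then obtain n :: nat where "y < real n * x"
      using reals_Archimedean3[of x] by auto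
    with *[of n] show False by simp
  qed
qed


section \<open>Principal ideals and uniform convergence\<close>

definition lattice_ideal :: "'a::vector_lattice set \<Rightarrow> bool"
  where "lattice_ideal I \<longleftrightarrow> subspace I \<and> (\<forall>x\<in>I. \<forall>y. \<bar>y\<bar> \<le> \<bar>x\<bar> \<longrightarrow> y \<in> I)"

definition principal_ideal :: "'a::vector_lattice \<Rightarrow> 'a set"
  where "principal_ideal e = lattice_ideal hull {e}"

text \<open>Only meaningful for \<open>x \<in> principal_ideal e\<close>; otherwise the infimum is over the empty set.\<close>

definition principal_norm :: "'a::vector_lattice \<Rightarrow> 'a \<Rightarrow> real"
  where "principal_norm e x = Inf {l. 0 < l \<and> \<bar>x\<bar> \<le> l *\<^sub>R e}"

text \<open>Convergence is stated along an arbitrary filter on the index type. A net indexed by a directed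
  set is the special case of the filter of eventual sets of that index set.\<close>

definition uniformly_converges ::
    "('i \<Rightarrow> 'a::vector_lattice) \<Rightarrow> 'a \<Rightarrow> 'i filter \<Rightarrow> bool"
  where "uniformly_converges f x \<F> \<longleftrightarrow>
    (\<exists>e\<ge>0. (\<forall>\<^sub>F i in \<F>. f i - x \<in> principal_ideal e) \<and>
            ((\<lambda>i. principal_norm e (f i - x)) \<longlongrightarrow> 0) \<F>)"

text \<open>A definition cannot quantify over index types, so closedness quantifies over the proper filters
  on the space itself. By \<open>uniformly_closedD\<close> this covers nets over every index type, and by
  \<open>uniformly_closed_iff\<close> it is closedness of the trace on each normed principal ideal.\<close>

definition uniformly_closed :: "'a::vector_lattice set \<Rightarrow> bool"
  where "uniformly_closed A \<longleftrightarrow>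
    (\<forall>\<F> x. \<F> \<noteq> bot \<longrightarrow> (\<forall>\<^sub>F y in \<F>. y \<in> A) \<longrightarrow> uniformly_converges (\<lambda>y. y) x \<F> \<longrightarrow> x \<in> A)"

lemma principal_ideal_eq:
  fixes e :: "'a::vector_lattice"
  assumes "0 \<le> e"
  shows "principal_ideal e = {x. \<exists>l>0. \<bar>x\<bar> \<le> l *\<^sub>R e}"
  unfolding principal_ideal_def
proof (rule hull_unique)
  show "{e} \<subseteq> {x. \<exists>l>0. \<bar>x\<bar> \<le> l *\<^sub>R e}"
    using assms by (auto intro!: exI[of _ 1])
  show "lattice_ideal {x. \<exists>l>0. \<bar>x\<bar> \<le> l *\<^sub>R e}"
    unfolding lattice_ideal_def
  proof (intro conjI ballI allI impI)
    show "subspace {x. \<exists>l>0. \<bar>x\<bar> \<le> l *\<^sub>R e}"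
      unfolding subspace_def
    proof (intro conjI ballI allI)
      show "0 \<in> {x. \<exists>l>0. \<bar>x\<bar> \<le> l *\<^sub>R e}"
        using assms by (auto intro!: exI[of _ 1])
    next
      fix x y assume "x \<in> {x. \<exists>l>0. \<bar>x\<bar> \<le> l *\<^sub>R e}" "y \<in> {x. \<exists>l>0. \<bar>x\<bar> \<le> l *\<^sub>R e}"
      then obtain l m where "l > 0" "m > 0" "\<bar>x\<bar> \<le> l *\<^sub>R e" "\<bar>y\<bar> \<le> m *\<^sub>R e" by auto
      moreover from this have "\<bar>x + y\<bar> \<le> (l + m) *\<^sub>R e"
        using order_trans[OF abs_triangle_ineq[of x y] add_mono[of "\<bar>x\<bar>" "l *\<^sub>R e" "\<bar>y\<bar>" "m *\<^sub>R e"]]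
        by (simp add: scaleR_left_distrib)
      ultimately show "x + y \<in> {x. \<exists>l>0. \<bar>x\<bar> \<le> l *\<^sub>R e}"
        by (auto intro!: exI[of _ "l + m"])
    next
      fix c :: real and x
      assume "x \<in> {x. \<exists>l>0. \<bar>x\<bar> \<le> l *\<^sub>R e}"
      then obtain l where l: "l > 0" "\<bar>x\<bar> \<le> l *\<^sub>R e" by auto
      have x: "x \<le> \<bar>x\<bar>" "- x \<le> \<bar>x\<bar>" by (rule abs_ge_self, rule abs_ge_minus_self)
      have 1: "c *\<^sub>R x \<le> \<bar>c\<bar> *\<^sub>R \<bar>x\<bar>"
      proof (cases "c \<ge> 0")
        case True
        then show ?thesis using scaleR_left_mono[OF x(1), of c] by simp
      next
        case False
        then show ?thesis using scaleR_left_mono[OF x(2), of "- c"] by simp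
      qed
      have 2: "- (c *\<^sub>R x) \<le> \<bar>c\<bar> *\<^sub>R \<bar>x\<bar>"
      proof (cases "c \<ge> 0")
        case True
        then show ?thesis using scaleR_left_mono[OF x(2), of c] by simp
      next
        case False
        then show ?thesis using scaleR_left_mono[OF x(1), of "- c"] by simp
      qed
      have "\<bar>c *\<^sub>R x\<bar> \<le> \<bar>c\<bar> *\<^sub>R \<bar>x\<bar>" using 1 2 by (rule abs_leI)
      also have "\<dots> \<le> \<bar>c\<bar> *\<^sub>R (l *\<^sub>R e)" using scaleR_left_mono[OF l(2), of "\<bar>c\<bar>"] by simp
      also have "\<dots> \<le> (\<bar>c\<bar> * l + 1) *\<^sub>R e"
        using assms by (simp add: scaleR_left_distrib)
      finally show "c *\<^sub>R x \<in> {x. \<exists>l>0. \<bar>x\<bar> \<le> l *\<^sub>R e}"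
        using l(1) by (intro CollectI exI[of _ "\<bar>c\<bar> * l + 1"]) (simp add: add_nonneg_pos)
    qed
  next
    fix x y assume "x \<in> {x. \<exists>l>0. \<bar>x\<bar> \<le> l *\<^sub>R e}" "\<bar>y\<bar> \<le> \<bar>x\<bar>"
    then show "y \<in> {x. \<exists>l>0. \<bar>x\<bar> \<le> l *\<^sub>R e}" by (auto intro: order_trans)
  qed
next
  fix I assume I: "{e} \<subseteq> I" "lattice_ideal I"
  show "{x. \<exists>l>0. \<bar>x\<bar> \<le> l *\<^sub>R e} \<subseteq> I"
  proof clarify
    fix x and l :: real assume l: "l > 0" "\<bar>x\<bar> \<le> l *\<^sub>R e"
    have "l *\<^sub>R e \<in> I" using I by (auto simp: lattice_ideal_def subspace_def)
    moreover have "\<bar>l *\<^sub>R e\<bar> = l *\<^sub>R e"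
      using l assms by (intro abs_of_nonneg scaleR_nonneg_nonneg) auto
    ultimately show "x \<in> I" using I l by (metis lattice_ideal_def)
  qed
qed

lemma principal_norm_less_iff:
  fixes e :: "'a::vector_lattice"
  assumes "0 \<le> e" "x \<in> principal_ideal e"
  shows "principal_norm e x < r \<longleftrightarrow> (\<exists>l. 0 < l \<and> l < r \<and> \<bar>x\<bar> \<le> l *\<^sub>R e)"
proof -
  have "{l. 0 < l \<and> \<bar>x\<bar> \<le> l *\<^sub>R e} \<noteq> {}"
    using assms by (auto simp: principal_ideal_eq)
  moreover have "bdd_below {l. 0 < l \<and> \<bar>x\<bar> \<le> l *\<^sub>R e}"
    by (rule bdd_belowI[of _ 0]) auto
  ultimately show ?thesis
    unfolding principal_norm_def by (subst cInf_less_iff) auto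
qed

lemma principal_norm_nonneg:
  fixes e :: "'a::vector_lattice"
  assumes "0 \<le> e" "x \<in> principal_ideal e"
  shows "0 \<le> principal_norm e x"
  using principal_norm_less_iff[OF assms, of 0] by fastforce

lemma uniformly_converges_iff:
  "uniformly_converges f x \<F> \<longleftrightarrow> (\<exists>e\<ge>0. \<forall>r>0. \<forall>\<^sub>F i in \<F>. \<bar>f i - x\<bar> \<le> r *\<^sub>R e)"
proof
  assume "uniformly_converges f x \<F>"
  then obtain e where e: "0 \<le> e" "\<forall>\<^sub>F i in \<F>. f i - x \<in> principal_ideal e"
    "((\<lambda>i. principal_norm e (f i - x)) \<longlongrightarrow> 0) \<F>"
    unfolding uniformly_converges_def by auto
  have "\<forall>\<^sub>F i in \<F>. \<bar>f i - x\<bar> \<le> r *\<^sub>R e" if "r > 0" for r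
    using e(2) order_tendstoD(2)[OF e(3) that]
  proof eventually_elim
    case (elim i)
    then obtain l where "l < r" "\<bar>f i - x\<bar> \<le> l *\<^sub>R e"
      using principal_norm_less_iff[OF e(1)] by blast
    then show ?case using order_trans[OF _ scaleR_right_mono[of l r e]] e(1) by simp
  qed
  then show "\<exists>e\<ge>0. \<forall>r>0. \<forall>\<^sub>F i in \<F>. \<bar>f i - x\<bar> \<le> r *\<^sub>R e" using e by blast
next
  assume "\<exists>e\<ge>0. \<forall>r>0. \<forall>\<^sub>F i in \<F>. \<bar>f i - x\<bar> \<le> r *\<^sub>R e"
  then obtain e where e: "0 \<le> e" "\<And>r. r > 0 \<Longrightarrow> \<forall>\<^sub>F i in \<F>. \<bar>f i - x\<bar> \<le> r *\<^sub>R e" by blast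
  have ideal: "\<forall>\<^sub>F i in \<F>. f i - x \<in> principal_ideal e"
    using e(2)[OF zero_less_one] by eventually_elim (auto simp: principal_ideal_eq[OF e(1)] intro!: exI[of _ 1])
  moreover have "((\<lambda>i. principal_norm e (f i - x)) \<longlongrightarrow> 0) \<F>"
  proof (rule order_tendstoI)
    fix a :: real assume "a < 0"
    show "\<forall>\<^sub>F i in \<F>. a < principal_norm e (f i - x)"
      using ideal by eventually_elim (use principal_norm_nonneg[OF e(1)] \<open>a < 0\<close> in force)
  next
    fix a :: real assume "0 < a"
    then have "0 < a / 2" by simp
    from ideal e(2)[OF this] show "\<forall>\<^sub>F i in \<F>. principal_norm e (f i - x) < a"
    proof eventually_elim
      case (elim i)
      then show ?case using principal_norm_less_iff[OF e(1) elim(1), of a] \<open>0 < a\<close>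
        by (auto intro!: exI[of _ "a / 2"])
    qed
  qed
  ultimately show "uniformly_converges f x \<F>" using e(1) unfolding uniformly_converges_def by blast
qed

lemma uniformly_closedD:
  assumes "uniformly_closed A" "\<F> \<noteq> bot" "\<forall>\<^sub>F i in \<F>. f i \<in> A" "uniformly_converges f x \<F>"
  shows "x \<in> A"
proof -
  have "filtermap f \<F> \<noteq> bot" "\<forall>\<^sub>F y in filtermap f \<F>. y \<in> A"
    using assms by (auto simp: filtermap_bot_iff eventually_filtermap)
  moreover have "uniformly_converges (\<lambda>y. y) x (filtermap f \<F>)"
    using assms(4) by (simp add: uniformly_converges_iff eventually_filtermap)
  ultimately show ?thesis using assms(1) unfolding uniformly_closed_def by blast
qed

lemma uniformly_closed_iff:
  "uniformly_closed A \<longleftrightarrow>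
    (\<forall>e\<ge>0. \<forall>x\<in>principal_ideal e.
      (\<forall>r>0. \<exists>a\<in>A \<inter> principal_ideal e. principal_norm e (a - x) < r) \<longrightarrow> x \<in> A \<inter> principal_ideal e)"
    (is "_ \<longleftrightarrow> ?R")
proof
  assume A: "uniformly_closed A"
  show ?R
  proof (intro allI ballI impI)
    fix e x :: 'a
    assume e: "0 \<le> e" and x: "x \<in> principal_ideal e"
      and *: "\<forall>r>0. \<exists>a\<in>A \<inter> principal_ideal e. principal_norm e (a - x) < r"
    have sub: "subspace (principal_ideal e)"
      unfolding principal_ideal_def hull_def lattice_ideal_def
      by (rule subspace_Inter) auto
    have "\<forall>n. \<exists>a. a \<in> A \<inter> principal_ideal e \<and> principal_norm e (a - x) < 1 / real (Suc n)"
      using * by (auto simp: Bex_def)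
    then obtain a where a: "\<And>n. a n \<in> A \<inter> principal_ideal e"
      "\<And>n. principal_norm e (a n - x) < 1 / real (Suc n)" by metis
    have d: "a n - x \<in> principal_ideal e" for n
      using a(1)[of n] x sub by (auto intro: subspace_diff)
    have "(\<lambda>n. principal_norm e (a n - x)) \<longlonglongrightarrow> 0"
    proof (rule tendsto_sandwich)
      show "\<forall>\<^sub>F n in sequentially. 0 \<le> principal_norm e (a n - x)"
        using principal_norm_nonneg[OF e d] by simp
      show "\<forall>\<^sub>F n in sequentially. principal_norm e (a n - x) \<le> 1 / real (Suc n)"
        using a(2) by (simp add: less_imp_le)
      show "(\<lambda>n. 1 / real (Suc n)) \<longlonglongrightarrow> 0"
        using LIMSEQ_inverse_real_of_nat by (simp add: inverse_eq_divide)
    qed simp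
    then have "uniformly_converges a x sequentially"
      unfolding uniformly_converges_def using e d by auto
    then have "x \<in> A" using uniformly_closedD[OF A, of sequentially a x] a(1) by auto
    then show "x \<in> A \<inter> principal_ideal e" using x by blast
  qed
next
  assume R: ?R
  show "uniformly_closed A"
    unfolding uniformly_closed_def
  proof (intro allI impI)
    fix \<F> :: "'a filter" and x
    assume F: "\<F> \<noteq> bot" "\<forall>\<^sub>F y in \<F>. y \<in> A" "uniformly_converges (\<lambda>y. y) x \<F>"
    then obtain e where e: "0 \<le> e" "\<And>r. r > 0 \<Longrightarrow> \<forall>\<^sub>F y in \<F>. \<bar>y - x\<bar> \<le> r *\<^sub>R e"
      unfolding uniformly_converges_iff by blast
    define u where "u = e + \<bar>x\<bar>"
    have u: "0 \<le> u" "e \<le> u" "\<bar>x\<bar> \<le> u" using e(1) by (auto simp: u_def)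
    have x: "x \<in> principal_ideal u"
      using u by (auto simp: principal_ideal_eq intro!: exI[of _ 1])
    have sub: "subspace (principal_ideal u)"
      unfolding principal_ideal_def hull_def lattice_ideal_def
      by (rule subspace_Inter) auto
    have "\<exists>a\<in>A \<inter> principal_ideal u. principal_norm u (a - x) < r" if "r > 0" for r
    proof -
      have "\<forall>\<^sub>F y in \<F>. y \<in> A \<and> \<bar>y - x\<bar> \<le> (r / 2) *\<^sub>R e"
        using F(2) e(2)[of "r / 2"] that by (simp add: eventually_conj)
      from eventually_happens'[OF F(1) this]
      obtain y where y: "y \<in> A" "\<bar>y - x\<bar> \<le> (r / 2) *\<^sub>R e" by blast
      have "(r / 2) *\<^sub>R e \<le> (r / 2) *\<^sub>R u" using u that by (intro scaleR_left_mono) auto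
      from order_trans[OF y(2) this] have y2: "\<bar>y - x\<bar> \<le> (r / 2) *\<^sub>R u" .
      then have d: "y - x \<in> principal_ideal u"
        using that u by (auto simp: principal_ideal_eq intro!: exI[of _ "r / 2"])
      have "principal_norm u (y - x) < r"
        using principal_norm_less_iff[OF u(1) d, of r] y2 that by (auto intro!: exI[of _ "r / 2"])
      moreover have "y \<in> principal_ideal u"
        using subspace_add[OF sub d x] by simp
      ultimately show ?thesis using y by blast
    qed
    then show "x \<in> A" using R u(1) x by blast
  qed
qed


section \<open>Codimension\<close>

text \<open>The quotient space consists of the cosets of \<open>F\<close>. In a linear combination of cosets, the final
  summand \<open>F\<close> (the zero of the quotient) makes the result a coset also when some coefficient is
  zero (elementwise scaling by 0 gives \<open>{0}\<close> rather than \<open>F\<close>) or when there are no summands.\<close>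

definition quotient_space :: "'a::real_vector set \<Rightarrow> 'a set set"
  where "quotient_space F = range (\<lambda>x. x +o F)"

definition coset_combination :: "'a::real_vector set \<Rightarrow> ('a set \<Rightarrow> real) \<Rightarrow> 'a set set \<Rightarrow> 'a set"
  where "coset_combination F c B = (\<Sum>Q\<in>B. (\<lambda>x. c Q *\<^sub>R x) ` Q) + F"

definition quotient_basis :: "'a::real_vector set \<Rightarrow> 'a set set \<Rightarrow> bool"
  where "quotient_basis F B \<longleftrightarrow>
    finite B \<and> B \<subseteq> quotient_space F \<and>
    (\<forall>c. coset_combination F c B = F \<longrightarrow> (\<forall>Q\<in>B. c Q = 0)) \<and>
    (\<forall>P\<in>quotient_space F. \<exists>c. P = coset_combination F c B)"

definition has_codimension :: "'a::real_vector set \<Rightarrow> nat \<Rightarrow> bool"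
  where "has_codimension F n \<longleftrightarrow> subspace F \<and> (\<exists>B. quotient_basis F B \<and> card B = n)"

lemma coset_eq_iff:
  assumes "subspace F"
  shows "x +o F = y +o F \<longleftrightarrow> x - y \<in> F"
proof
  assume "x +o F = y +o F"
  moreover have "x \<in> x +o F" using subspace_0[OF assms] by (auto simp: elt_set_plus_def)
  ultimately show "x - y \<in> F" by (auto simp: elt_set_plus_def)
next
  assume d: "x - y \<in> F"
  show "x +o F = y +o F"
  proof (intro set_eqI iffI)
    fix z assume "z \<in> x +o F"
    then obtain f where "f \<in> F" "z = x + f" by (auto simp: elt_set_plus_def)
    then show "z \<in> y +o F"
      using subspace_add[OF assms d] by (auto simp: elt_set_plus_def intro!: bexI[of _ "x - y + f"])
  next
    fix z assume "z \<in> y +o F"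
    then obtain f where "f \<in> F" "z = y + f" by (auto simp: elt_set_plus_def)
    then show "z \<in> x +o F"
      using subspace_diff[OF assms _ d]
      by (auto simp: elt_set_plus_def intro!: bexI[of _ "f - (x - y)"])
  qed
qed

lemma coset_combination_image:
  assumes F: "subspace F" and "finite R" "inj_on (\<lambda>x. x +o F) R"
  shows "coset_combination F c ((\<lambda>x. x +o F) ` R) = (\<Sum>x\<in>R. c (x +o F) *\<^sub>R x) +o F"
  using assms(2,3)
proof (induction R rule: finite_induct)
  case empty
  then show ?case by (simp add: coset_combination_def elt_set_plus_def set_plus_def)
next
  case (insert r R)
  have scale: "(\<lambda>x. a *\<^sub>R x) ` (r +o F) + (s +o F) = (a *\<^sub>R r + s) +o F" for a s
  proof (intro set_eqI iffI)
    fix z assume "z \<in> (\<lambda>x. a *\<^sub>R x) ` (r +o F) + (s +o F)"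
    then obtain f g where "f \<in> F" "g \<in> F" "z = a *\<^sub>R (r + f) + (s + g)"
      by (auto simp: elt_set_plus_def set_plus_def)
    then show "z \<in> (a *\<^sub>R r + s) +o F"
      using subspace_add[OF F subspace_scale[OF F, of f a]]
      by (auto simp: elt_set_plus_def algebra_simps intro!: bexI[of _ "a *\<^sub>R f + g"])
  next
    fix z assume "z \<in> (a *\<^sub>R r + s) +o F"
    then obtain f where f: "f \<in> F" "z = a *\<^sub>R r + s + f" by (auto simp: elt_set_plus_def)
    have "a *\<^sub>R r \<in> (\<lambda>x. a *\<^sub>R x) ` (r +o F)"
      using subspace_0[OF F] by (auto simp: elt_set_plus_def image_iff intro!: bexI[of _ 0])
    moreover have "s + f \<in> s +o F" using f by (auto simp: elt_set_plus_def)
    ultimately show "z \<in> (\<lambda>x. a *\<^sub>R x) ` (r +o F) + (s +o F)"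
      unfolding set_plus_def f(2) add.assoc by blast
  qed
  have "r +o F \<notin> (\<lambda>x. x +o F) ` R" using insert by (auto simp: inj_on_def)
  then have "coset_combination F c ((\<lambda>x. x +o F) ` insert r R) =
      (\<lambda>x. c (r +o F) *\<^sub>R x) ` (r +o F) + coset_combination F c ((\<lambda>x. x +o F) ` R)"
    using insert(1) by (simp add: coset_combination_def add.assoc)
  also have "\<dots> = (\<Sum>x\<in>insert r R. c (x +o F) *\<^sub>R x) +o F"
    using insert by (simp add: scale)
  finally show ?case .
qed

lemma has_codimension_iff:
  "has_codimension F n \<longleftrightarrow> subspace F \<and>
    (\<exists>R. finite R \<and> card R = n \<and>
      (\<forall>c. (\<Sum>x\<in>R. c x *\<^sub>R x) \<in> F \<longrightarrow> (\<forall>x\<in>R. c x = 0)) \<and>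
      (\<forall>y. \<exists>c. y - (\<Sum>x\<in>R. c x *\<^sub>R x) \<in> F))"
    (is "_ \<longleftrightarrow> _ \<and> ?R")
proof (cases "subspace F")
  case F: True
  let ?q = "\<lambda>x. x +o F"
  have zero: "s +o F = F \<longleftrightarrow> s \<in> F" for s
    using coset_eq_iff[OF F, of s 0] by (simp add: elt_set_plus_def)
  have key: "quotient_basis F (?q ` R) \<longleftrightarrow>
      (\<forall>c. (\<Sum>x\<in>R. c x *\<^sub>R x) \<in> F \<longrightarrow> (\<forall>x\<in>R. c x = 0)) \<and>
      (\<forall>y. \<exists>c. y - (\<Sum>x\<in>R. c x *\<^sub>R x) \<in> F)"
    if R: "finite R" and inj: "inj_on ?q R" for R
  proof -
    have lift: "\<exists>d. \<forall>x\<in>R. d (?q x) = c x" for c :: "'a \<Rightarrow> real"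
      by (rule exI[of _ "\<lambda>Q. c (inv_into R ?q Q)"]) (simp add: inv_into_f_f[OF inj])
    have 1: "(\<forall>c. (\<Sum>x\<in>R. c (?q x) *\<^sub>R x) \<in> F \<longrightarrow> (\<forall>x\<in>R. c (?q x) = 0)) \<longleftrightarrow>
        (\<forall>c. (\<Sum>x\<in>R. c x *\<^sub>R x) \<in> F \<longrightarrow> (\<forall>x\<in>R. c x = 0))" (is "?A \<longleftrightarrow> ?B")
    proof
      assume A: ?A
      show ?B
      proof (intro allI impI)
        fix c assume c: "(\<Sum>x\<in>R. c x *\<^sub>R x) \<in> F"
        obtain d where d: "\<forall>x\<in>R. d (?q x) = c x" using lift by blast
        then have "(\<Sum>x\<in>R. d (?q x) *\<^sub>R x) = (\<Sum>x\<in>R. c x *\<^sub>R x)" by (intro sum.cong) auto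
        with c A have "\<forall>x\<in>R. d (?q x) = 0" by auto
        with d show "\<forall>x\<in>R. c x = 0" by auto
      qed
    next
      assume B: ?B
      show ?A
      proof (intro allI impI)
        fix c assume "(\<Sum>x\<in>R. c (?q x) *\<^sub>R x) \<in> F"
        then show "\<forall>x\<in>R. c (?q x) = 0" using B[rule_format, of "\<lambda>x. c (?q x)"] by blast
      qed
    qed
    have 2: "(\<exists>c. y - (\<Sum>x\<in>R. c (?q x) *\<^sub>R x) \<in> F) \<longleftrightarrow> (\<exists>c. y - (\<Sum>x\<in>R. c x *\<^sub>R x) \<in> F)" for y
    proof
      assume "\<exists>c. y - (\<Sum>x\<in>R. c x *\<^sub>R x) \<in> F"
      then obtain c where c: "y - (\<Sum>x\<in>R. c x *\<^sub>R x) \<in> F" by blast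
      obtain d where d: "\<forall>x\<in>R. d (?q x) = c x" using lift by blast
      then have "(\<Sum>x\<in>R. d (?q x) *\<^sub>R x) = (\<Sum>x\<in>R. c x *\<^sub>R x)" by (intro sum.cong) auto
      with c show "\<exists>c. y - (\<Sum>x\<in>R. c (?q x) *\<^sub>R x) \<in> F" by metis
    next
      assume "\<exists>c. y - (\<Sum>x\<in>R. c (?q x) *\<^sub>R x) \<in> F"
      then obtain c where "y - (\<Sum>x\<in>R. c (?q x) *\<^sub>R x) \<in> F" by blast
      then show "\<exists>c. y - (\<Sum>x\<in>R. c x *\<^sub>R x) \<in> F" by (intro exI[of _ "\<lambda>x. c (?q x)"])
    qed
    have "quotient_basis F (?q ` R) \<longleftrightarrow>
        (\<forall>c. (\<Sum>x\<in>R. c (?q x) *\<^sub>R x) \<in> F \<longrightarrow> (\<forall>x\<in>R. c (?q x) = 0)) \<and>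
        (\<forall>y. \<exists>c. y - (\<Sum>x\<in>R. c (?q x) *\<^sub>R x) \<in> F)"
      unfolding quotient_basis_def quotient_space_def
      using R by (auto simp: coset_combination_image[OF F R inj] zero coset_eq_iff[OF F])
    then show ?thesis using 1 2 by simp
  qed
  have "(\<exists>B. quotient_basis F B \<and> card B = n) \<longleftrightarrow> ?R"
  proof
    assume "\<exists>B. quotient_basis F B \<and> card B = n"
    then obtain B where B: "quotient_basis F B" "card B = n" by blast
    then have "B \<subseteq> range ?q" "finite B" by (auto simp: quotient_basis_def quotient_space_def)
    then obtain R where R: "inj_on ?q R" "B = ?q ` R"
      by (metis subset_image_inj)
    have "finite R" using \<open>finite B\<close> R finite_imageD by auto
    moreover have "card R = n" using B(2) R card_image[OF R(1)] by simp
    moreover note key[OF \<open>finite R\<close> R(1), folded R(2), THEN iffD1, OF B(1)]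
    ultimately show ?R by (intro exI[of _ R] conjI) simp_all
  next
    assume ?R
    then obtain R where R: "finite R" "card R = n"
      "\<forall>c. (\<Sum>x\<in>R. c x *\<^sub>R x) \<in> F \<longrightarrow> (\<forall>x\<in>R. c x = 0)"
      "\<forall>y. \<exists>c. y - (\<Sum>x\<in>R. c x *\<^sub>R x) \<in> F" by blast
    have inj: "inj_on ?q R"
    proof (rule inj_onI, rule ccontr)
      fix x y assume xy: "x \<in> R" "y \<in> R" "?q x = ?q y" "x \<noteq> y"
      let ?c = "\<lambda>z. (if z = x then 1 else 0) - (if z = y then 1 else 0) :: real"
      have "(\<Sum>z\<in>R. ?c z *\<^sub>R z) =
          (\<Sum>z\<in>R. (if z = x then 1 else 0) *\<^sub>R z) - (\<Sum>z\<in>R. (if z = y then 1 else 0) *\<^sub>R z)"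
        by (simp add: scaleR_left_diff_distrib sum_subtractf)
      also have "(\<Sum>z\<in>R. (if z = x then 1 else 0) *\<^sub>R z) = (\<Sum>z\<in>R. if z = x then z else 0)"
        by (intro sum.cong) auto
      also have "\<dots> = x" using xy R(1) by simp
      also have "(\<Sum>z\<in>R. (if z = y then 1 else 0) *\<^sub>R z) = (\<Sum>z\<in>R. if z = y then z else 0)"
        by (intro sum.cong) auto
      also have "\<dots> = y" using xy R(1) by simp
      finally have "(\<Sum>z\<in>R. ?c z *\<^sub>R z) \<in> F" using xy coset_eq_iff[OF F] by simp
      then have "?c x = 0" using R(3)[rule_format, of ?c x] xy(1) by blast
      with xy show False by simp
    qed
    show "\<exists>B. quotient_basis F B \<and> card B = n"
      using key[OF R(1) inj, THEN iffD2, OF conjI[OF R(3,4)]] card_image[OF inj] R(2)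
      by (intro exI[of _ "?q ` R"]) simp
  qed
  then show ?thesis using F by (simp add: has_codimension_def)
qed (simp add: has_codimension_def)

end

theory Submission
  imports Defs
begin

text \<open>Let \<open>F\<close> be uniformly closed of codimension \<open>n\<close>, and let \<open>R\<close> be a set of \<open>n\<close> vectors whose
  cosets form a basis of \<open>X/F\<close>. For each \<open>r \<in> R\<close> the span \<open>G\<^sub>r\<close> of \<open>F \<union> (R - {r})\<close> has codimension
  \<open>1\<close>, and \<open>F\<close> is the intersection of the \<open>G\<^sub>r\<close>, since a vector of \<open>G\<^sub>r\<close> has coordinate \<open>0\<close> at \<open>r\<close>.

  It remains to see that \<open>G\<^sub>r\<close> is uniformly closed. As for normed spaces, the sum of a closed subspace
  and a finite-dimensional one is closed; by induction it suffices to adjoin one vector \<open>x \<notin> F\<close>.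
  For each \<open>e\<close>, the distance of \<open>x\<close> from \<open>F\<close> relative to \<open>e\<close> is positive, so for vectors
  \<open>f + c x\<close> with \<open>f \<in> F\<close> the coefficient \<open>c\<close> is controlled by the size relative to \<open>e\<close>.
  If a sequence of such vectors converges, then so do the coefficients, by completeness of \<open>\<real>\<close>,
  and hence also the components in \<open>F\<close>.\<close>

lemma abs_scaleR_le:
  fixes x :: "'a::vector_lattice"
  shows "\<bar>c *\<^sub>R x\<bar> \<le> \<bar>c\<bar> *\<^sub>R \<bar>x\<bar>"
proof (cases "c \<ge> 0")
  case True
  show ?thesis
    using True scaleR_left_mono[OF abs_ge_self[of x] True]
      scaleR_left_mono[OF abs_ge_minus_self[of x] True]
    by (intro abs_leI) auto
next
  case False
  then have "0 \<le> - c" by simp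
  then show ?thesis
    using False scaleR_left_mono[OF abs_ge_self[of x], of "- c"]
      scaleR_left_mono[OF abs_ge_minus_self[of x], of "- c"]
    by (intro abs_leI) auto
qed

lemma uniformly_converges_sequentiallyI:
  fixes y :: "nat \<Rightarrow> 'a::vector_lattice"
  assumes "0 \<le> e" "s \<longlonglongrightarrow> 0" "\<And>n. \<bar>y n - x\<bar> \<le> s n *\<^sub>R e"
  shows "uniformly_converges y x sequentially"
  unfolding uniformly_converges_iff
proof (intro exI[of _ e] conjI allI impI assms(1))
  fix r :: real
  assume "r > 0"
  with assms(2) have "\<forall>\<^sub>F n in sequentially. s n < r" by (rule order_tendstoD)
  then show "\<forall>\<^sub>F n in sequentially. \<bar>y n - x\<bar> \<le> r *\<^sub>R e"
  proof eventually_elim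
    case (elim n)
    then have "s n *\<^sub>R e \<le> r *\<^sub>R e" using assms(1) by (intro scaleR_right_mono) auto
    with assms(3)[of n] show ?case by (rule order_trans)
  qed
qed

lemma uniformly_closed_sequentialD:
  fixes A :: "'a::vector_lattice set"
  assumes "uniformly_closed A" "0 \<le> e" "s \<longlonglongrightarrow> 0"
    and "\<And>n. y n \<in> A" "\<And>n. \<bar>y n - x\<bar> \<le> s n *\<^sub>R e"
  shows "x \<in> A"
  using uniformly_closedD[OF assms(1) _ _ uniformly_converges_sequentiallyI[OF assms(2,3,5)]] assms(4)
  by simp

lemma LIMSEQ_one_over_Suc: "(\<lambda>n. 1 / real (Suc n)) \<longlonglongrightarrow> 0"
  using LIMSEQ_inverse_real_of_nat by (simp add: inverse_eq_divide)

lemma uniformly_closed_sequentialI: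
  fixes A :: "'a::vector_lattice set"
  assumes "\<And>e x y. 0 \<le> e \<Longrightarrow> (\<And>n::nat. y n \<in> A) \<Longrightarrow>
    (\<And>n. \<bar>y n - x\<bar> \<le> (1 / real (Suc n)) *\<^sub>R e) \<Longrightarrow> x \<in> A"
  shows "uniformly_closed A"
  unfolding uniformly_closed_def uniformly_converges_iff
proof (intro allI impI)
  fix \<F> :: "'a filter" and x
  assume F: "\<F> \<noteq> bot" "\<forall>\<^sub>F y in \<F>. y \<in> A"
    and "\<exists>e\<ge>0. \<forall>r>0. \<forall>\<^sub>F y in \<F>. \<bar>y - x\<bar> \<le> r *\<^sub>R e"
  then obtain e where e: "0 \<le> e" "\<And>r. r > 0 \<Longrightarrow> \<forall>\<^sub>F y in \<F>. \<bar>y - x\<bar> \<le> r *\<^sub>R e" by blast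
  have "\<exists>y. y \<in> A \<and> \<bar>y - x\<bar> \<le> (1 / real (Suc n)) *\<^sub>R e" for n
    using eventually_happens'[OF F(1) eventually_conj[OF F(2) e(2)[of "1 / real (Suc n)"]]] by simp
  then obtain y where "\<And>n. y n \<in> A" "\<And>n. \<bar>y n - x\<bar> \<le> (1 / real (Suc n)) *\<^sub>R e" by metis
  with e(1) show "x \<in> A" by (rule assms)
qed

text \<open>A vector outside a uniformly closed subspace has positive distance from it relative to every
  \<open>e\<close>; by homogeneity this bounds the coefficient of \<open>x\<close>, uniformly in the component in \<open>F\<close>.\<close>

lemma coefficient_bound:
  fixes F :: "'a::vector_lattice set"
  assumes F: "subspace F" "uniformly_closed F" and x: "x \<notin> F" and e: "0 \<le> e"
  obtains d where "d > 0" "\<And>f c r. f \<in> F \<Longrightarrow> \<bar>f + c *\<^sub>R x\<bar> \<le> r *\<^sub>R e \<Longrightarrow> 0 \<le> r \<Longrightarrow> \<bar>c\<bar> * d \<le> r"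
proof -
  have "\<exists>d>0. \<forall>f\<in>F. \<not> \<bar>f - x\<bar> \<le> d *\<^sub>R e"
  proof (rule ccontr)
    assume "\<not> ?thesis"
    then have "\<exists>f. f \<in> F \<and> \<bar>f - x\<bar> \<le> (1 / real (Suc n)) *\<^sub>R e" for n
      by (metis of_nat_0_less_iff zero_less_Suc zero_less_divide_1_iff)
    then obtain f where "\<And>n. f n \<in> F" "\<And>n. \<bar>f n - x\<bar> \<le> (1 / real (Suc n)) *\<^sub>R e" by metis
    with uniformly_closed_sequentialD[OF F(2) e LIMSEQ_one_over_Suc] x show False by blast
  qed
  then obtain d where d: "d > 0" "\<And>f. f \<in> F \<Longrightarrow> \<not> \<bar>f - x\<bar> \<le> d *\<^sub>R e" by blast
  have "\<bar>c\<bar> * d \<le> r" if f: "f \<in> F" "\<bar>f + c *\<^sub>R x\<bar> \<le> r *\<^sub>R e" "0 \<le> r" for f c r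
  proof (rule ccontr)
    assume "\<not> \<bar>c\<bar> * d \<le> r"
    then have less: "r < \<bar>c\<bar> * d" and c: "c \<noteq> 0" using f(3) by auto
    have "(- 1 / c) *\<^sub>R f - x = (- 1 / c) *\<^sub>R (f + c *\<^sub>R x)"
      using c by (simp add: scaleR_right_distrib)
    then have "\<bar>(- 1 / c) *\<^sub>R f - x\<bar> \<le> \<bar>- 1 / c\<bar> *\<^sub>R \<bar>f + c *\<^sub>R x\<bar>"
      by (metis abs_scaleR_le)
    also have "\<dots> \<le> \<bar>- 1 / c\<bar> *\<^sub>R (r *\<^sub>R e)"
      using f(2) by (rule scaleR_left_mono) simp
    also have "\<dots> = (r / \<bar>c\<bar>) *\<^sub>R e" by (simp add: abs_divide)
    also have "\<dots> \<le> d *\<^sub>R e"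
      using less c e by (intro scaleR_right_mono) (auto simp: field_simps)
    finally show False using d(2) subspace_scale[OF F(1) f(1)] by blast
  qed
  with d(1) show ?thesis by (rule that)
qed

lemma uniformly_closed_span_insert:
  fixes F :: "'a::vector_lattice set"
  assumes F: "subspace F" "uniformly_closed F"
  shows "uniformly_closed (span (insert x F))"
proof (cases "x \<in> F")
  case True
  then have "span (insert x F) = F" using F(1) by (simp add: insert_absorb span_eq_iff)
  then show ?thesis using F(2) by simp
next
  case x: False
  have mem: "z \<in> span (insert x F) \<longleftrightarrow> (\<exists>c. z - c *\<^sub>R x \<in> F)" for z
    using F(1) by (simp add: span_breakdown_eq span_eq_iff[THEN iffD2])
  show ?thesis
  proof (rule uniformly_closed_sequentialI)
    fix e z :: 'a and y :: "nat \<Rightarrow> 'a"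
    assume e: "0 \<le> e" and y: "\<And>n. y n \<in> span (insert x F)"
      and conv: "\<And>n. \<bar>y n - z\<bar> \<le> (1 / real (Suc n)) *\<^sub>R e"
    let ?s = "\<lambda>n. 1 / real (Suc n)"
    obtain c where c: "\<And>n. y n - c n *\<^sub>R x \<in> F" using y unfolding mem by metis
    obtain d where d: "d > 0"
      "\<And>f c r. f \<in> F \<Longrightarrow> \<bar>f + c *\<^sub>R x\<bar> \<le> r *\<^sub>R e \<Longrightarrow> 0 \<le> r \<Longrightarrow> \<bar>c\<bar> * d \<le> r"
      using coefficient_bound[OF F x e] by blast
    \<comment> \<open>\<open>y m - y n\<close> has coefficient \<open>c m - c n\<close> and tends to \<open>0\<close>, so the coefficients form a
      Cauchy sequence.\<close>
    have diff: "\<bar>c m - c n\<bar> * d \<le> ?s m + ?s n" for m n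
    proof (rule d(2))
      show "(y m - c m *\<^sub>R x) - (y n - c n *\<^sub>R x) \<in> F" using F(1) c c by (rule subspace_diff)
      have "(y m - c m *\<^sub>R x) - (y n - c n *\<^sub>R x) + (c m - c n) *\<^sub>R x = (y m - z) + - (y n - z)"
        by (simp add: scaleR_left_diff_distrib)
      also have "\<bar>\<dots>\<bar> \<le> \<bar>y m - z\<bar> + \<bar>- (y n - z)\<bar>" by (rule abs_triangle_ineq)
      also have "\<dots> \<le> ?s m *\<^sub>R e + ?s n *\<^sub>R e"
        unfolding abs_minus_cancel by (intro add_mono conv)
      finally show "\<bar>(y m - c m *\<^sub>R x) - (y n - c n *\<^sub>R x) + (c m - c n) *\<^sub>R x\<bar> \<le> (?s m + ?s n) *\<^sub>R e"
        by (simp add: scaleR_left_distrib)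
    qed simp
    have "Cauchy c"
    proof (rule CauchyI)
      fix r :: real
      assume "0 < r"
      then have "0 < r * d / 2" using d(1) by simp
      from order_tendstoD(2)[OF LIMSEQ_one_over_Suc this]
      obtain N where N: "\<And>n. n \<ge> N \<Longrightarrow> ?s n < r * d / 2" by (auto simp: eventually_sequentially)
      have "norm (c m - c n) < r" if "m \<ge> N" "n \<ge> N" for m n
      proof -
        have "\<bar>c m - c n\<bar> * d < r * d" using diff[of m n] N[OF that(1)] N[OF that(2)] by linarith
        then show ?thesis using d(1) by simp
      qed
      then show "\<exists>M. \<forall>m\<ge>M. \<forall>n\<ge>M. norm (c m - c n) < r" by blast
    qed
    then obtain l where l: "c \<longlonglongrightarrow> l" using Cauchy_convergent convergent_def by blast
    \<comment> \<open>The components in \<open>F\<close> need not converge relative to \<open>e\<close>, because \<open>x\<close> need not lie in the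
      ideal generated by \<open>e\<close>; they converge relative to \<open>e + \<bar>x\<bar>\<close>.\<close>
    have "z - l *\<^sub>R x \<in> F"
    proof (rule uniformly_closed_sequentialD[OF F(2), where y = "\<lambda>n. y n - c n *\<^sub>R x"
          and s = "\<lambda>n. ?s n + \<bar>l - c n\<bar>" and e = "e + \<bar>x\<bar>"])
      show "0 \<le> e + \<bar>x\<bar>" using e by (simp add: add_nonneg_nonneg)
      have "(\<lambda>n. \<bar>l - c n\<bar>) \<longlonglongrightarrow> \<bar>l - l\<bar>" by (intro tendsto_intros l)
      with tendsto_add[OF LIMSEQ_one_over_Suc this]
      show "(\<lambda>n. ?s n + \<bar>l - c n\<bar>) \<longlonglongrightarrow> 0" by simp
      show "y n - c n *\<^sub>R x \<in> F" for n by (rule c)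
      fix n
      have "(y n - c n *\<^sub>R x) - (z - l *\<^sub>R x) = (y n - z) + (l - c n) *\<^sub>R x"
        by (simp add: scaleR_left_diff_distrib)
      also have "\<bar>\<dots>\<bar> \<le> \<bar>y n - z\<bar> + \<bar>(l - c n) *\<^sub>R x\<bar>" by (rule abs_triangle_ineq)
      also have "\<dots> \<le> ?s n *\<^sub>R e + \<bar>l - c n\<bar> *\<^sub>R \<bar>x\<bar>" by (intro add_mono conv abs_scaleR_le)
      also have "\<dots> \<le> (?s n + \<bar>l - c n\<bar>) *\<^sub>R e + (?s n + \<bar>l - c n\<bar>) *\<^sub>R \<bar>x\<bar>"
        using e by (intro add_mono scaleR_right_mono) auto
      finally show "\<bar>(y n - c n *\<^sub>R x) - (z - l *\<^sub>R x)\<bar> \<le> (?s n + \<bar>l - c n\<bar>) *\<^sub>R (e + \<bar>x\<bar>)"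
        by (simp add: scaleR_right_distrib)
    qed
    then show "z \<in> span (insert x F)" using mem by blast
  qed
qed

lemma uniformly_closed_span_Un_finite:
  fixes F :: "'a::vector_lattice set"
  assumes "finite S" "subspace F" "uniformly_closed F"
  shows "uniformly_closed (span (F \<union> S))"
  using assms(1)
proof (induction S rule: finite_induct)
  case empty
  then show ?case using assms(2,3) by (simp add: span_eq_iff[THEN iffD2])
next
  case (insert x S)
  have "span (F \<union> insert x S) = span (insert x (span (F \<union> S)))"
    by (simp add: span_insert span_span)
  then show ?case using uniformly_closed_span_insert[OF subspace_span insert.IH] by simp
qed

lemma span_Un_finite_sum:
  fixes F :: "'a::real_vector set"
  assumes "finite S" "subspace F" "y \<in> span (F \<union> S)"
  obtains c where "y - (\<Sum>x\<in>S. c x *\<^sub>R x) \<in> F"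
proof -
  have "\<exists>f\<in>F. \<exists>s\<in>span S. y = f + s"
    using assms(2,3) by (auto simp: span_Un span_eq_iff[THEN iffD2])
  then obtain f s where "f \<in> F" "s \<in> span S" "y = f + s" by blast
  moreover from this(2) obtain c where "s = (\<Sum>x\<in>S. c x *\<^sub>R x)"
    unfolding span_finite[OF assms(1)] by blast
  ultimately show ?thesis using that[of c] by simp
qed

lemma has_codimension_oneI:
  fixes G :: "'a::real_vector set"
  assumes "subspace G" "r \<notin> G" "span (insert r G) = UNIV"
  shows "has_codimension G 1"
  unfolding has_codimension_iff
proof (intro conjI exI[of _ "{r}"] allI impI assms(1))
  fix c :: "'a \<Rightarrow> real"
  assume "(\<Sum>x\<in>{r}. c x *\<^sub>R x) \<in> G"
  then have "c r *\<^sub>R r \<in> G" by simp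
  then have "c r = 0" using assms(2) subspace_scale[OF assms(1), of "c r *\<^sub>R r" "1 / c r"]
    by (auto split: if_splits)
  then show "\<forall>x\<in>{r}. c x = 0" by simp
next
  fix y
  have "y \<in> span (insert r G)" using assms(3) by simp
  then obtain k where "y - k *\<^sub>R r \<in> G"
    using assms(1) by (auto simp: span_breakdown_eq span_eq_iff[THEN iffD2])
  then show "\<exists>c. y - (\<Sum>x\<in>{r}. c x *\<^sub>R x) \<in> G" by (intro exI[of _ "\<lambda>_. k"]) simp
qed simp_all

theorem corollary4p6:
  fixes F :: "'a::archimedean_vector_lattice set"
  assumes "subspace F"
    and "uniformly_closed F"
    and "\<exists>n. has_codimension F n"
  shows "\<exists>\<G>. (\<forall>G\<in>\<G>. subspace G \<and> uniformly_closed G \<and> has_codimension G 1) \<and> F = \<Inter>\<G>"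
proof -
  obtain R where R: "finite R"
    and indep: "\<And>c. (\<Sum>x\<in>R. c x *\<^sub>R x) \<in> F \<Longrightarrow> \<forall>x\<in>R. c x = 0"
    and gen: "\<And>y. \<exists>c. y - (\<Sum>x\<in>R. c x *\<^sub>R x) \<in> F"
    using assms(3) unfolding has_codimension_iff by blast
  define G where "G r = span (F \<union> (R - {r}))" for r
  have FG: "F \<subseteq> G r" for r unfolding G_def by (auto intro: span_base)
  have coordinate: "c r = 0" if r: "r \<in> R" "y \<in> G r" and c: "y - (\<Sum>x\<in>R. c x *\<^sub>R x) \<in> F" for c r y
  proof -
    obtain b where b: "y - (\<Sum>x\<in>R - {r}. b x *\<^sub>R x) \<in> F"
      using span_Un_finite_sum[of "R - {r}" F y] R assms(1) r(2) unfolding G_def by blast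
    \<comment> \<open>Extended by \<open>0\<close> at \<open>r\<close>, the coefficients \<open>b\<close> represent \<open>y\<close> modulo \<open>F\<close> over all of \<open>R\<close>,
      and such coefficients are unique.\<close>
    let ?b = "b(r := 0)"
    have "(\<Sum>x\<in>R. ?b x *\<^sub>R x) = (\<Sum>x\<in>R - {r}. ?b x *\<^sub>R x)"
      using r(1) R by (simp add: sum.remove)
    also have "\<dots> = (\<Sum>x\<in>R - {r}. b x *\<^sub>R x)" by (intro sum.cong) auto
    finally have "y - (\<Sum>x\<in>R. ?b x *\<^sub>R x) \<in> F" using b by simp
    from subspace_diff[OF assms(1) this c]
    have "(\<Sum>x\<in>R. (c x - ?b x) *\<^sub>R x) \<in> F"
      by (simp add: scaleR_left_diff_distrib sum_subtractf)
    from indep[OF this] r(1) show ?thesis by fastforce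
  qed
  have "has_codimension (G r) 1" if r: "r \<in> R" for r
  proof (rule has_codimension_oneI)
    show "subspace (G r)" unfolding G_def by (rule subspace_span)
    show "r \<notin> G r"
    proof
      assume "r \<in> G r"
      moreover have "(\<Sum>x\<in>R. (if x = r then 1 else 0) *\<^sub>R x) = r"
      proof -
        have "(\<Sum>x\<in>R. (if x = r then 1 else 0) *\<^sub>R x) = (\<Sum>x\<in>R. if x = r then x else 0)"
          by (intro sum.cong) auto
        also have "\<dots> = r" using r R by simp
        finally show ?thesis .
      qed
      ultimately show False
        using coordinate[OF r, of r "\<lambda>x. if x = r then 1 else 0"] subspace_0[OF assms(1)] by simp
    qed
    show "span (insert r (G r)) = UNIV"
    proof (intro UNIV_eq_I[symmetric])
      fix y
      obtain c where c: "y - (\<Sum>x\<in>R. c x *\<^sub>R x) \<in> F" using gen by blast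
      have R': "R \<subseteq> insert r (G r)" unfolding G_def by (auto intro: span_base)
      have "y - (\<Sum>x\<in>R. c x *\<^sub>R x) \<in> span (insert r (G r))"
        using c FG by (auto intro: span_base)
      moreover have "(\<Sum>x\<in>R. c x *\<^sub>R x) \<in> span (insert r (G r))"
        using R' by (intro span_sum span_scale span_base) auto
      ultimately have "(y - (\<Sum>x\<in>R. c x *\<^sub>R x)) + (\<Sum>x\<in>R. c x *\<^sub>R x) \<in> span (insert r (G r))"
        by (rule span_add)
      then show "y \<in> span (insert r (G r))" by simp
    qed
  qed
  moreover have "subspace (G r)" "uniformly_closed (G r)" for r
    unfolding G_def using R assms by (auto intro: subspace_span uniformly_closed_span_Un_finite)
  moreover have "F = \<Inter> (G ` R)"
  proof
    show "F \<subseteq> \<Inter> (G ` R)" using FG by blast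
    show "\<Inter> (G ` R) \<subseteq> F"
    proof
      fix y
      assume y: "y \<in> \<Inter> (G ` R)"
      obtain c where c: "y - (\<Sum>x\<in>R. c x *\<^sub>R x) \<in> F" using gen by blast
      have "c x = 0" if "x \<in> R" for x using coordinate[OF that _ c] y that by blast
      then have "(\<Sum>x\<in>R. c x *\<^sub>R x) = 0" by (intro sum.neutral) auto
      with c show "y \<in> F" by simp
    qed
  qed
  ultimately show ?thesis by (intro exI[of _ "G ` R"]) auto
qed

end
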